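(* Let $k$ be a field and $n$ a positive integer. Let $\mathcal{T}(n)$ be the set of all triples $(A,B,\gamma)\in \mathrm{M}_n(k)\times \mathrm{M}_n(k)\times k^n$ such that $AB = BA = -B^2$ and $B\gamma = 0$. Then any crossed product $k^n_0 \# k_0$ is isomorphic to a Leibniz algebra, denoted by $k^{n+1}_{(A,B,\gamma)}$, which has the basis $\{E_1,\dots,E_{n+1}\}$ and the bracket defined by $$\{E_i,E_{n+1}\} := \sum_{j=1}^n a_{ji}E_j,\qquad \{E_{n+1},E_i\} := \sum_{j=1}^n b_{ji}E_j,\qquad \{E_{n+1},E_{n+1}\} := \sum_{j=1}^n \gamma_j E_j$$ for all $i=1,\dots,n$ (all other brackets of basis elements being zero), for some $(A=(a_{ij}),B=(b_{ij}),\gamma=(\gamma_i))\in\mathcal{T}(n)$. Furthermore, $\mathbb{HL}^2(k_0,k^n_0)\cong \mathcal{T}(n)/\approx$, where $\approx$ is the following relation on $\mathcal{T}(n)$: $(A,B,\gamma)\approx(A',B',\gamma')$ if and only if $A=A'$, $B=B'$ and there exists $r\in k^n$ such that $\gamma = \gamma' + (B+A)r$.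
   Context: All vector spaces and (bi)linear maps are over an arbitrary field $k$. A Leibniz algebra is a vector space with a bilinear bracket satisfying $[x,[y,z]] = [[x,y],z] - [[x,z],y]$. For a vector space $V$, $V_0$ denotes $V$ with the zero (abelian) bracket. For vector spaces $\mathfrak{g}$, $\mathfrak{L}$, a crossed product $\mathfrak{g}_0\#\mathfrak{L}_0$ is a Leibniz algebra with underlying vector space $\mathfrak{g}\times\mathfrak{L}$ and bracket of the form $\{(g,x),(h,y)\} = (x\triangleright h + g\triangleleft y + f(x,y),0)$ for some bilinear maps $\triangleleft : \mathfrak{g}\times\mathfrak{L}\to\mathfrak{g}$, $\triangleright : \mathfrak{L}\times\mathfrak{g}\to\mathfrak{g}$, $f : \mathfrak{L}\times\mathfrak{L}\to\mathfrak{g}$. Here $\mathfrak{g}=k^n$ and $\mathfrak{L}=k$. $\mathbb{HL}^2(\mathfrak{L}_0,\mathfrak{g}_0)$ is the set of all triples $(\triangleleft,\triangleright,f)$ of bilinear maps $\triangleleft : \mathfrak{g}\times\mathfrak{L}\to\mathfrak{g}$, $\triangleright : \mathfrak{L}\times\mathfrak{g}\to\mathfrak{g}$, $f : \mathfrak{L}\times\mathfrak{L}\to\mathfrak{g}$ for which the bracket $\{(g,x),(h,y)\} = (x\triangleright h + g\triangleleft y + f(x,y),0)$ on $\mathfrak{g}\times\mathfrak{L}$ is a Leibniz bracket, modulo the equivalence relation: $(\triangleleft,\triangleright,f)\approx(\triangleleft',\triangleright',f')$ iff $\triangleleft=\triangleleft'$, $\triangleright=\triangleright'$ and there is a linear map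 $r:\mathfrak{L}\to\mathfrak{g}$ with $f(x,y) = f'(x,y) + x\triangleright' r(y) + r(x)\triangleleft' y$ for all $x,y\in\mathfrak{L}$. *)

theory Defs
  imports "HOL-Analysis.Analysis"
begin

text \<open>Vector spaces over a field are given by their scalar multiplications, as in the theory
  \<open>Vector_Spaces\<close>. On \<open>'k ^ 'n\<close> the scalar multiplication is \<open>(*s)\<close>, on \<open>'k\<close> it is \<open>(*)\<close>, and on a
  product it is \<open>module_prod.scale\<close>.\<close>

definition bilinear_map ::
  "('k::field \<Rightarrow> 'a::ab_group_add \<Rightarrow> 'a) \<Rightarrow> ('k \<Rightarrow> 'b::ab_group_add \<Rightarrow> 'b) \<Rightarrow>
   ('k \<Rightarrow> 'c::ab_group_add \<Rightarrow> 'c) \<Rightarrow> ('a \<Rightarrow> 'b \<Rightarrow> 'c) \<Rightarrow> bool" where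
  "bilinear_map s1 s2 s3 b \<longleftrightarrow>
     (\<forall>x. Vector_Spaces.linear s2 s3 (\<lambda>y. b x y)) \<and>
     (\<forall>y. Vector_Spaces.linear s1 s3 (\<lambda>x. b x y))"

text \<open>The bracket is not assumed to be antisymmetric; the identity is the one of right Leibniz
  algebras.\<close>

locale leibniz_algebra = vector_space scale
  for scale :: "'k::field \<Rightarrow> 'v::ab_group_add \<Rightarrow> 'v" +
  fixes bracket :: "'v \<Rightarrow> 'v \<Rightarrow> 'v"
  assumes bilinear_bracket: "bilinear_map scale scale scale bracket"
    and leibniz: "bracket x (bracket y z) = bracket (bracket x y) z - bracket (bracket x z) y"

definition leibniz_iso ::
  "('k::field \<Rightarrow> 'v::ab_group_add \<Rightarrow> 'v) \<Rightarrow> ('v \<Rightarrow> 'v \<Rightarrow> 'v) \<Rightarrow>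
   ('k \<Rightarrow> 'w::ab_group_add \<Rightarrow> 'w) \<Rightarrow> ('w \<Rightarrow> 'w \<Rightarrow> 'w) \<Rightarrow> ('v \<Rightarrow> 'w) \<Rightarrow> bool" where
  "leibniz_iso s1 b1 s2 b2 \<phi> \<longleftrightarrow>
     Vector_Spaces.linear s1 s2 \<phi> \<and> bij \<phi> \<and> (\<forall>u v. \<phi> (b1 u v) = b2 (\<phi> u) (\<phi> v))"

definition leibniz_isomorphic ::
  "('k::field \<Rightarrow> 'v::ab_group_add \<Rightarrow> 'v) \<Rightarrow> ('v \<Rightarrow> 'v \<Rightarrow> 'v) \<Rightarrow>
   ('k \<Rightarrow> 'w::ab_group_add \<Rightarrow> 'w) \<Rightarrow> ('w \<Rightarrow> 'w \<Rightarrow> 'w) \<Rightarrow> bool" where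
  "leibniz_isomorphic s1 b1 s2 b2 \<longleftrightarrow>
     leibniz_algebra s1 b1 \<and> leibniz_algebra s2 b2 \<and> (\<exists>\<phi>. leibniz_iso s1 b1 s2 b2 \<phi>)"


text \<open>Triples \<open>(\<triangleleft>, \<triangleright>, f)\<close>; below the first two components are called \<open>ra\<close> (\<open>g \<triangleleft> x = ra g x\<close>)
  and \<open>la\<close> (\<open>x \<triangleright> g = la x g\<close>).\<close>

type_synonym ('l, 'g) crossed_triple =
  "('g \<Rightarrow> 'l \<Rightarrow> 'g) \<times> ('l \<Rightarrow> 'g \<Rightarrow> 'g) \<times> ('l \<Rightarrow> 'l \<Rightarrow> 'g)"

fun crossed_bracket ::
  "('l::zero, 'g::plus) crossed_triple \<Rightarrow> 'g \<times> 'l \<Rightarrow> 'g \<times> 'l \<Rightarrow> 'g \<times> 'l" where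
  "crossed_bracket (ra, la, f) (g, x) (h, y) = (la x h + ra g y + f x y, 0)"

definition crossed_triples ::
  "('k::field \<Rightarrow> 'l::ab_group_add \<Rightarrow> 'l) \<Rightarrow> ('k \<Rightarrow> 'g::ab_group_add \<Rightarrow> 'g) \<Rightarrow>
   ('l, 'g) crossed_triple set" where
  "crossed_triples sL sg = {(ra, la, f).
     bilinear_map sg sL sg ra \<and> bilinear_map sL sg sg la \<and> bilinear_map sL sL sg f \<and>
     leibniz_algebra (module_prod.scale sg sL) (crossed_bracket (ra, la, f))}"

definition crossed_product ::
  "('k::field \<Rightarrow> 'g::ab_group_add \<Rightarrow> 'g) \<Rightarrow> ('k \<Rightarrow> 'l::ab_group_add \<Rightarrow> 'l) \<Rightarrow>
   ('g \<times> 'l \<Rightarrow> 'g \<times> 'l \<Rightarrow> 'g \<times> 'l) \<Rightarrow> bool" where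
  "crossed_product sg sL br \<longleftrightarrow> (\<exists>t \<in> crossed_triples sL sg. br = crossed_bracket t)"

definition crossed_equiv ::
  "('k::field \<Rightarrow> 'l::ab_group_add \<Rightarrow> 'l) \<Rightarrow> ('k \<Rightarrow> 'g::ab_group_add \<Rightarrow> 'g) \<Rightarrow>
   (('l, 'g) crossed_triple \<times> ('l, 'g) crossed_triple) set" where
  "crossed_equiv sL sg = {((ra, la, f), (ra', la', f')).
     (ra, la, f) \<in> crossed_triples sL sg \<and> (ra', la', f') \<in> crossed_triples sL sg \<and>
     ra = ra' \<and> la = la' \<and>
     (\<exists>r. Vector_Spaces.linear sL sg r \<and>
          (\<forall>x y. f x y = f' x y + la' x (r y) + ra' (r x) y))}"

definition HL2 ::
  "('k::field \<Rightarrow> 'l::ab_group_add \<Rightarrow> 'l) \<Rightarrow> ('k \<Rightarrow> 'g::ab_group_add \<Rightarrow> 'g) \<Rightarrow>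
   ('l, 'g) crossed_triple set set" where
  "HL2 sL sg = crossed_triples sL sg // crossed_equiv sL sg"

lemma equiv_crossed_equiv: "equiv (crossed_triples sL sg) (crossed_equiv sL sg)"
proof (rule equivI)
  show "crossed_equiv sL sg \<subseteq> crossed_triples sL sg \<times> crossed_triples sL sg"
    by (auto simp: crossed_equiv_def)
  have vs: "vector_space sL \<and> vector_space sg" if "t \<in> crossed_triples sL sg" for t
    using that unfolding crossed_triples_def bilinear_map_def Vector_Spaces.linear_def by auto
  have la: "la x (a + b) = la x a + la x b" "la x 0 = 0" "la x (- a) = - la x a"
    if "(ra, la, f) \<in> crossed_triples sL sg" for ra la f x a b
  proof -
    from that have "Vector_Spaces.linear sg sg (la x)"
      by (auto simp: crossed_triples_def bilinear_map_def)
    then interpret l: Vector_Spaces.linear sg sg "la x" .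
    show "la x (a + b) = la x a + la x b" "la x 0 = 0" "la x (- a) = - la x a"
      by (rule l.add l.zero l.neg)+
  qed
  have ra: "ra (a + b) y = ra a y + ra b y" "ra 0 y = 0" "ra (- a) y = - ra a y"
    if "(ra, la, f) \<in> crossed_triples sL sg" for ra la f y a b
  proof -
    from that have "Vector_Spaces.linear sg sg (\<lambda>g. ra g y)"
      by (auto simp: crossed_triples_def bilinear_map_def)
    then interpret l: Vector_Spaces.linear sg sg "\<lambda>g. ra g y" .
    show "ra (a + b) y = ra a y + ra b y" "ra 0 y = 0" "ra (- a) y = - ra a y"
      by (rule l.add l.zero l.neg)+
  qed
  show "refl_on (crossed_triples sL sg) (crossed_equiv sL sg)"
  proof (rule refl_onI)
    fix t assume t: "t \<in> crossed_triples sL sg"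
    obtain a b f where t': "t = (a, b, f)" by (cases t) auto
    interpret vector_space_pair sL sg using vs[OF t] by (simp add: vector_space_pair_def)
    show "(t, t) \<in> crossed_equiv sL sg" unfolding t' crossed_equiv_def
      using t[unfolded t'] la(2)[OF t[unfolded t']] ra(2)[OF t[unfolded t']]
      by (auto intro!: exI[of _ "\<lambda>_. 0"] module_hom_zero[unfolded module_hom_eq_linear])
  qed
  show "sym (crossed_equiv sL sg)"
  proof (rule symI)
    fix t t' assume tt: "(t, t') \<in> crossed_equiv sL sg"
    obtain a b f where t1: "t = (a, b, f)" by (cases t) auto
    from tt obtain f' where t2: "t' = (a, b, f')" unfolding t1 crossed_equiv_def by auto
    from tt t1 t2 obtain r where r: "Vector_Spaces.linear sL sg r"
      and f: "\<And>x y. f x y = f' x y + b x (r y) + a (r x) y"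
      and m: "(a, b, f) \<in> crossed_triples sL sg" "(a, b, f') \<in> crossed_triples sL sg"
      unfolding crossed_equiv_def by blast
    interpret vector_space_pair sL sg using vs[OF m(1)] by (simp add: vector_space_pair_def)
    have r': "Vector_Spaces.linear sL sg (\<lambda>x. - r x)"
      using r by (rule linear_compose_neg)
    show "(t', t) \<in> crossed_equiv sL sg" unfolding t1 t2 crossed_equiv_def
      using m r' by (auto intro!: exI[of _ "\<lambda>x. - r x"] simp: f la(3)[OF m(1)] ra(3)[OF m(1)])
  qed
  show "trans (crossed_equiv sL sg)"
  proof (rule transI)
    fix t t' t'' assume tt: "(t, t') \<in> crossed_equiv sL sg" "(t', t'') \<in> crossed_equiv sL sg"
    obtain a b f where t1: "t = (a, b, f)" by (cases t) auto
    from tt(1) obtain f' where t2: "t' = (a, b, f')" unfolding t1 crossed_equiv_def by auto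
    from tt(2) obtain f'' where t3: "t'' = (a, b, f'')" unfolding t2 crossed_equiv_def by auto
    from tt(1) t1 t2 obtain r where r: "Vector_Spaces.linear sL sg r"
      and f: "\<And>x y. f x y = f' x y + b x (r y) + a (r x) y"
      and m: "(a, b, f) \<in> crossed_triples sL sg"
      unfolding crossed_equiv_def by blast
    from tt(2) t2 t3 obtain q where q: "Vector_Spaces.linear sL sg q"
      and f': "\<And>x y. f' x y = f'' x y + b x (q y) + a (q x) y"
      and m': "(a, b, f'') \<in> crossed_triples sL sg"
      unfolding crossed_equiv_def by blast
    interpret vector_space_pair sL sg using vs[OF m] by (simp add: vector_space_pair_def)
    have "Vector_Spaces.linear sL sg (\<lambda>x. r x + q x)"
      using r q by (rule linear_compose_add)
    then show "(t, t'') \<in> crossed_equiv sL sg" unfolding t1 t3 crossed_equiv_def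
      using m m'
      by (auto intro!: exI[of _ "\<lambda>x. r x + q x"] simp: f f' la(1)[OF m] ra(1)[OF m] algebra_simps)
  qed
qed


type_synonym ('k, 'n) matrix_triple = "('k ^ 'n ^ 'n) \<times> ('k ^ 'n ^ 'n) \<times> ('k ^ 'n)"

definition leibniz_matrix_triples :: "('k::field, 'n::finite) matrix_triple set" where
  "leibniz_matrix_triples =
     {(A, B, \<gamma>). A ** B = B ** A \<and> B ** A = - (B ** B) \<and> B *v \<gamma> = 0}"

definition matrix_triple_equiv ::
  "(('k::field, 'n::finite) matrix_triple \<times> ('k, 'n) matrix_triple) set" where
  "matrix_triple_equiv = {((A, B, \<gamma>), (A', B', \<gamma>')).
     (A, B, \<gamma>) \<in> leibniz_matrix_triples \<and> (A', B', \<gamma>') \<in> leibniz_matrix_triples \<and>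
     A = A' \<and> B = B' \<and> (\<exists>r. \<gamma> = \<gamma>' + (B + A) *v r)}"

lemma equiv_matrix_triple_equiv:
  "equiv leibniz_matrix_triples
     (matrix_triple_equiv :: (('k::field, 'n::finite) matrix_triple \<times> _) set)"
proof (rule equivI)
  show "(matrix_triple_equiv :: (('k, 'n) matrix_triple \<times> _) set)
      \<subseteq> leibniz_matrix_triples \<times> leibniz_matrix_triples"
    by (auto simp: matrix_triple_equiv_def)
  show "refl_on leibniz_matrix_triples
      (matrix_triple_equiv :: (('k, 'n) matrix_triple \<times> _) set)"
    by (rule refl_onI) (auto simp: matrix_triple_equiv_def intro!: exI[of _ 0])
  show "sym (matrix_triple_equiv :: (('k, 'n) matrix_triple \<times> _) set)"
  proof (rule symI)
    fix t t' :: "('k, 'n) matrix_triple"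
    assume "(t, t') \<in> matrix_triple_equiv"
    then obtain A B \<gamma> \<gamma>' r where t: "t = (A, B, \<gamma>)" "t' = (A, B, \<gamma>')"
      and m: "t \<in> leibniz_matrix_triples" "t' \<in> leibniz_matrix_triples"
      and r: "\<gamma> = \<gamma>' + (B + A) *v r"
      unfolding matrix_triple_equiv_def by auto
    have "\<gamma>' = \<gamma> + (B + A) *v (- r)"
      by (simp add: r vec.neg)
    then show "(t', t) \<in> matrix_triple_equiv"
      using m unfolding t matrix_triple_equiv_def by blast
  qed
  show "trans (matrix_triple_equiv :: (('k, 'n) matrix_triple \<times> _) set)"
  proof (rule transI)
    fix t t' t'' :: "('k, 'n) matrix_triple"
    assume a: "(t, t') \<in> matrix_triple_equiv" "(t', t'') \<in> matrix_triple_equiv"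
    from a(1) obtain A B \<gamma> \<gamma>' r where t: "t = (A, B, \<gamma>)" "t' = (A, B, \<gamma>')"
      and m: "t \<in> leibniz_matrix_triples"
      and r: "\<gamma> = \<gamma>' + (B + A) *v r"
      unfolding matrix_triple_equiv_def by auto
    from a(2) obtain \<gamma>'' q where t'': "t'' = (A, B, \<gamma>'')"
      and m'': "t'' \<in> leibniz_matrix_triples"
      and q: "\<gamma>' = \<gamma>'' + (B + A) *v q"
      unfolding matrix_triple_equiv_def t by auto
    have "\<gamma> = \<gamma>'' + (B + A) *v (q + r)"
      by (simp only: r q vec.add add.assoc)
    then show "(t, t'') \<in> matrix_triple_equiv"
      using m m'' unfolding t t'' matrix_triple_equiv_def by blast
  qed
qed


text \<open>For \<open>n = CARD('n)\<close> the space of dimension \<open>n + 1\<close> is \<open>'k ^ 'n option\<close>: the index \<open>Some i\<close>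
  stands for \<open>i \<le> n\<close> and \<open>None\<close> for \<open>n + 1\<close>. Thus \<open>std_E (Some i)\<close> are the first \<open>n\<close> vectors of the
  standard basis and \<open>std_E None\<close> is the last one.\<close>

abbreviation std_E :: "'n::finite option \<Rightarrow> 'k::field ^ 'n option" where
  "std_E p \<equiv> axis p 1"

fun basis_bracket ::
  "('k::field, 'n::finite) matrix_triple \<Rightarrow>
   'n option \<Rightarrow> 'n option \<Rightarrow> 'k ^ 'n option" where
  "basis_bracket (A, B, \<gamma>) (Some i) None = (\<Sum>j\<in>UNIV. A $ j $ i *s std_E (Some j))"
| "basis_bracket (A, B, \<gamma>) None (Some i) = (\<Sum>j\<in>UNIV. B $ j $ i *s std_E (Some j))"
| "basis_bracket (A, B, \<gamma>) None None = (\<Sum>j\<in>UNIV. \<gamma> $ j *s std_E (Some j))"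
| "basis_bracket (A, B, \<gamma>) (Some i) (Some j) = 0"

definition matrix_bracket ::
  "('k::field, 'n::finite) matrix_triple \<Rightarrow>
   'k ^ 'n option \<Rightarrow> 'k ^ 'n option \<Rightarrow> 'k ^ 'n option" where
  "matrix_bracket t u v =
     (\<Sum>p\<in>UNIV. \<Sum>q\<in>UNIV. (u $ p * v $ q) *s basis_bracket t p q)"

lemma range_std_E: "range std_E = (cart_basis :: ('k::field ^ 'n::finite option) set)"
  by (auto simp: cart_basis_def)

lemma bilinear_matrix_bracket: "bilinear_map (*s) (*s) (*s) (matrix_bracket t)"
  unfolding bilinear_map_def
proof (intro conjI allI)
  fix x show "Vector_Spaces.linear (*s) (*s) (matrix_bracket t x)"
    by unfold_locales
      (auto simp: matrix_bracket_def vec.scale_sum_right vec.scale_left_distrib sum.distrib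
        distrib_left mult.left_commute intro!: sum.cong)
next
  fix y show "Vector_Spaces.linear (*s) (*s) (\<lambda>x. matrix_bracket t x y)"
    by unfold_locales
      (auto simp: matrix_bracket_def vec.scale_sum_right vec.scale_left_distrib sum.distrib
        distrib_right mult.assoc intro!: sum.cong)
qed

lemma matrix_bracket_E: "matrix_bracket t (std_E p) (std_E q) = basis_bracket t p q"
proof -
  have "matrix_bracket t (std_E p) (std_E q) =
      (\<Sum>p'\<in>UNIV. if p' = p then (\<Sum>q'\<in>UNIV. if q' = q then basis_bracket t p' q' else 0) else 0)"
    unfolding matrix_bracket_def
  proof (intro sum.cong refl)
    fix p'
    have "(\<Sum>q'\<in>UNIV. (std_E p $ p' * std_E q $ q') *s basis_bracket t p' q') =
        (\<Sum>q'\<in>UNIV. if p' = p then (if q' = q then basis_bracket t p' q' else 0) else 0)"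
      by (intro sum.cong refl) (auto simp: axis_def)
    then show "(\<Sum>q'\<in>UNIV. (std_E p $ p' * std_E q $ q') *s basis_bracket t p' q') =
        (if p' = p then (\<Sum>q'\<in>UNIV. if q' = q then basis_bracket t p' q' else 0) else 0)"
      by (simp split: if_splits)
  qed
  then show ?thesis by simp
qed

end

theory Submission
  imports Defs
begin

text \<open>A bilinear map with an argument in \<open>k\<close> is determined by its value at \<open>1\<close>, so a triple
  \<open>(\<triangleleft>, \<triangleright>, f)\<close> amounts to \<open>(A, B, \<gamma>)\<close> with \<open>g \<triangleleft> x = x A g\<close>, \<open>x \<triangleright> g = x B g\<close> and
  \<open>f x y = x y \<gamma>\<close>. The Leibniz identity then compares two polynomials in the scalars \<open>x, y, z\<close>
  (the terms with \<open>A \<gamma>\<close> cancel), and the coefficients of \<open>x z\<close>, \<open>x y\<close> and \<open>x y z\<close> give \<open>B A = A B\<close>,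
  \<open>B B = - A B\<close> and \<open>B \<gamma> = 0\<close>. Likewise a linear map \<open>k \<rightarrow> k\<^sup>n\<close> is \<open>x \<mapsto> x r\<close>, which matches the two
  equivalence relations.\<close>

section \<open>Generalities on quotients and on transport of structure\<close>

lemma bij_betw_quotient_image:
  assumes A: "equiv A R" and B: "equiv B S" and F: "bij_betw F A B"
    and rel: "\<And>x y. x \<in> A \<Longrightarrow> y \<in> A \<Longrightarrow> (F x, F y) \<in> S \<longleftrightarrow> (x, y) \<in> R"
  shows "bij_betw ((`) F) (A // R) (B // S)"
    and "x \<in> A \<Longrightarrow> F ` (R `` {x}) = S `` {F x}"
proof -
  \<comment> \<open>The image is a full \<open>S\<close>-class because \<open>F\<close> is onto
    \<open>B\<close>: an element related to \<open>F x\<close> lies in \<open>B\<close>, hence is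
    some \<open>F y\<close>, and \<open>rel\<close> pulls the relation back to
    \<open>A\<close>.\<close>
  have cls: "F ` (R `` {x}) = S `` {F x}" if "x \<in> A" for x
  proof
    show "F ` (R `` {x}) \<subseteq> S `` {F x}"
      using A rel that by (auto simp: equiv_def)
    show "S `` {F x} \<subseteq> F ` (R `` {x})"
    proof
      fix z assume "z \<in> S `` {F x}"
      then have z: "(F x, z) \<in> S" "z \<in> B" using B by (auto simp: equiv_def)
      then obtain y where "y \<in> A" "z = F y" using F by (auto simp: bij_betw_def)
      then show "z \<in> F ` (R `` {x})" using rel that z by auto
    qed
  qed
  then show "x \<in> A \<Longrightarrow> F ` (R `` {x}) = S `` {F x}" .
  have "inj_on ((`) F) (A // R)"
  \<comment> \<open>Taking images under \<open>F\<close> is injective on subsets of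
    \<open>A\<close>, and every class is such a subset.\<close>
  proof (rule inj_on_subset[OF inj_on_image_Pow])
    show "inj_on F A" using F by (rule bij_betw_imp_inj_on)
    show "A // R \<subseteq> Pow A" using A by (auto simp: quotient_def equiv_def)
  qed
  moreover have "(`) F ` (A // R) = B // S"
  proof -
    have "(`) F ` (A // R) = (\<lambda>x. S `` {F x}) ` A"
      by (simp add: quotient_def UNION_singleton_eq_range image_image cls)
    also have "\<dots> = (\<lambda>y. S `` {y}) ` F ` A" by (simp add: image_image)
    also have "\<dots> = B // S"
      using F by (simp add: bij_betw_def quotient_def UNION_singleton_eq_range)
    finally show ?thesis .
  qed
  ultimately show "bij_betw ((`) F) (A // R) (B // S)" by (simp add: bij_betw_def)
qed

lemma sum_UNIV_option:
  "(\<Sum>p\<in>UNIV. f p) = f None + (\<Sum>i\<in>UNIV. f (Some i))"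
  for f :: "'n::finite option \<Rightarrow> 'a::comm_monoid_add"
  by (simp add: UNIV_option_conv sum.reindex)

text \<open>Every element of the target is a value of \<open>\<phi>\<close>, so the identity there
  is the image of the one in the source. This spares a direct check of the identity for
  \<open>matrix_bracket\<close>.\<close>

lemma leibniz_algebra_iso:
  assumes iso: "leibniz_iso s1 b1 s2 b2 \<phi>" and alg: "leibniz_algebra s1 b1"
    and bil: "bilinear_map s2 s2 s2 b2"
  shows "leibniz_algebra s2 b2"
proof -
  interpret l: Vector_Spaces.linear s1 s2 \<phi> using iso by (simp add: leibniz_iso_def)
  have hom: "b2 (\<phi> u) (\<phi> v) = \<phi> (b1 u v)" for u v using iso by (simp add: leibniz_iso_def)
  show ?thesis
  proof (unfold_locales, rule bil)
    fix x y z
    obtain u v w where "x = \<phi> u" "y = \<phi> v" "z = \<phi> w"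
      using iso by (metis leibniz_iso_def bij_pointE)
    then show "b2 x (b2 y z) = b2 (b2 x y) z - b2 (b2 x z) y"
      using leibniz_algebra.leibniz[OF alg, of u v w] by (simp add: hom l.diff)
  qed
qed

section \<open>Crossed triples over k as matrix triples\<close>

interpretation kn_k: vector_space_prod
  "(*s) :: 'k::field \<Rightarrow> 'k ^ 'n \<Rightarrow> 'k ^ 'n" "(*) :: 'k \<Rightarrow> 'k \<Rightarrow> 'k"
  by unfold_locales

definition crossed_of_matrix ::
  "('k::field, 'n::finite) matrix_triple \<Rightarrow> ('k, 'k ^ 'n) crossed_triple" where
  "crossed_of_matrix = (\<lambda>(A, B, \<gamma>).
     (\<lambda>g x. x *s (A *v g), \<lambda>x g. x *s (B *v g), \<lambda>x y. (x * y) *s \<gamma>))"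

definition matrix_of_crossed ::
  "('k::field, 'k ^ 'n::finite) crossed_triple \<Rightarrow> ('k, 'n) matrix_triple" where
  "matrix_of_crossed = (\<lambda>(ra, la, f). (matrix (\<lambda>g. ra g 1), matrix (la 1), f 1 1))"

lemma matrix_of_crossed_of_matrix: "matrix_of_crossed (crossed_of_matrix t) = t"
  by (cases t) (simp add: matrix_of_crossed_def crossed_of_matrix_def)

lemma linear_scalar:
  assumes "Vector_Spaces.linear (*) s r" shows "r x = s x (r 1)"
proof -
  interpret Vector_Spaces.linear "(*)" s r by (rule assms)
  show ?thesis using scale[of x 1] by simp
qed

lemma crossed_of_matrix_of_crossed:
  fixes ra :: "'k::field ^ 'n::finite \<Rightarrow> 'k \<Rightarrow> 'k ^ 'n"
  assumes ra: "bilinear_map (*s) (*) (*s) ra" and la: "bilinear_map (*) (*s) (*s) la"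
    and f: "bilinear_map (*) (*) (*s) f"
  shows "crossed_of_matrix (matrix_of_crossed (ra, la, f)) = (ra, la, f)"
proof -
  have "x *s (matrix (\<lambda>g. ra g 1) *v g) = ra g x" for g x
    using ra linear_scalar[of "(*s)" "ra g" x]
    by (simp add: bilinear_map_def matrix_works)
  moreover have "x *s (matrix (la 1) *v g) = la x g" for g x
    using la linear_scalar[of "(*s)" "\<lambda>x. la x g" x]
    by (simp add: bilinear_map_def matrix_works)
  \<comment> \<open>The scalars come out one argument at a time: \<open>f x y = x *s f 1 y\<close>
    and \<open>f 1 y = y *s f 1 1\<close>.\<close>
  moreover have "(x * y) *s f 1 1 = f x y" for x y
    using f linear_scalar[of "(*s)" "\<lambda>x. f x y" x] linear_scalar[of "(*s)" "f 1" y]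
    by (simp add: bilinear_map_def)
  ultimately show ?thesis
    by (simp add: crossed_of_matrix_def matrix_of_crossed_def)
qed

lemma crossed_bracket_of_matrix:
  "crossed_bracket (crossed_of_matrix (A, B, \<gamma>)) (g, x) (h, y) =
     (x *s (B *v h) + y *s (A *v g) + (x * y) *s \<gamma>, 0)"
  by (simp add: crossed_of_matrix_def)

lemmas vec_simps = vec.add vec.scale vec.scale_right_distrib vec.scale_left_distrib
  vec.scale_scale

lemma bilinear_crossed_of_matrix:
  assumes "crossed_of_matrix t = (ra, la, f)"
  shows "bilinear_map (*s) (*) (*s) ra" "bilinear_map (*) (*s) (*s) la"
    "bilinear_map (*) (*) (*s) f"
proof -
  obtain A B \<gamma> where t: "t = (A, B, \<gamma>)" by (cases t) auto
  have "ra = (\<lambda>g x. x *s (A *v g))" "la = (\<lambda>x g. x *s (B *v g))" "f = (\<lambda>x y. (x * y) *s \<gamma>)"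
    using assms by (auto simp: t crossed_of_matrix_def)
  then show "bilinear_map (*s) (*) (*s) ra" "bilinear_map (*) (*s) (*s) la"
    "bilinear_map (*) (*) (*s) f"
    by (auto simp: bilinear_map_def Vector_Spaces.linear_iff vec_simps algebra_simps
        vec.vector_space_axioms vector_space_over_itself.vector_space_axioms)
qed

lemma bilinear_crossed_bracket:
  fixes t :: "('k::field, 'n::finite) matrix_triple"
  shows "bilinear_map kn_k.scale kn_k.scale kn_k.scale (crossed_bracket (crossed_of_matrix t))"
proof -
  obtain A B \<gamma> where t: "t = (A, B, \<gamma>)" by (cases t) auto
  show ?thesis
    by (auto simp: t bilinear_map_def Vector_Spaces.linear_iff kn_k.p.vector_space_axioms
        crossed_bracket_of_matrix kn_k.scale_prod vec_simps algebra_simps)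
qed

section \<open>The Leibniz identity in terms of matrices\<close>

lemma uminus_matrix_vector_mult: "(- A) *v x = - (A *v x)"
  for A :: "'a::ring_1 ^ 'n ^ 'm"
  by (simp add: matrix_vector_mult_def vec_eq_iff sum_negf)

lemma leibniz_crossed_bracket_iff:
  fixes t :: "('k::field, 'n::finite) matrix_triple"
  shows "leibniz_algebra kn_k.scale (crossed_bracket (crossed_of_matrix t)) \<longleftrightarrow>
    t \<in> leibniz_matrix_triples"
proof -
  obtain A B \<gamma> where t: "t = (A, B, \<gamma>)" by (cases t) auto
  let ?b = "crossed_bracket (crossed_of_matrix (A, B, \<gamma>))"
  \<comment> \<open>The inner bracket has scalar component 0, so only the left action of
    \<open>x\<close> on it survives and \<open>g\<close> drops out.\<close>
  have lhs: "?b (g, x) (?b (h, y) (l, z)) =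
      ((x * y) *s (B *v (B *v l)) + (x * z) *s (B *v (A *v h)) + (x * y * z) *s (B *v \<gamma>), 0)"
    for g h l x y z
    by (simp add: crossed_bracket_of_matrix vec_simps algebra_simps)
  \<comment> \<open>Both iterated brackets contain \<open>(y * z) *s (A *v (A *v g))\<close> and
    \<open>(x * y * z) *s (A *v \<gamma>)\<close>, which cancel in the difference.\<close>
  have rhs: "?b (?b (g, x) (h, y)) (l, z) - ?b (?b (g, x) (l, z)) (h, y) =
      ((x * z) *s (A *v (B *v h)) - (x * y) *s (A *v (B *v l)), 0)"
    for g h l x y z
    by (simp add: crossed_bracket_of_matrix vec_simps algebra_simps)
  show ?thesis
  proof
    assume "leibniz_algebra kn_k.scale (crossed_bracket (crossed_of_matrix t))"
    from leibniz_algebra.leibniz[OF this[unfolded t]]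
    have eq: "(x * y) *s (B *v (B *v l)) + (x * z) *s (B *v (A *v h)) + (x * y * z) *s (B *v \<gamma>)
        = (x * z) *s (A *v (B *v h)) - (x * y) *s (A *v (B *v l))" for x y z h l
      unfolding lhs rhs by (metis fst_conv lhs rhs)
    \<comment> \<open>The values are given in the order \<open>x\<close>, \<open>y\<close>,
      \<open>l\<close>, \<open>z\<close>, \<open>h\<close>. Zero vectors isolate
      \<open>\<gamma>\<close>, then \<open>y = 0\<close> isolates \<open>h\<close> and
      \<open>z = 0\<close> isolates \<open>l\<close>. Only the scalars 0 and 1 occur, so the
      separation of coefficients works over every field, however small.\<close>
    have "B *v \<gamma> = 0" using eq[of 1 1 0 1 0] by (simp add: vec.zero)
    moreover have "B *v (A *v h) = A *v (B *v h)" for h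
      using eq[of 1 0 0 1 h] by (simp add: vec.zero)
    moreover have "B *v (B *v l) = - (A *v (B *v l))" for l
      using eq[of 1 1 l 0 0] by (simp add: vec.zero)
    ultimately show "t \<in> leibniz_matrix_triples"
      by (simp add: t leibniz_matrix_triples_def matrix_eq matrix_vector_mul_assoc[symmetric]
          uminus_matrix_vector_mult)
  next
    assume "t \<in> leibniz_matrix_triples"
    then have "A ** B = B ** A" "B ** A = - (B ** B)" and 0: "B *v \<gamma> = 0"
      by (auto simp: t leibniz_matrix_triples_def)
    then have comm: "B *v (A *v h) = A *v (B *v h)" and sq: "B *v (B *v l) = - (A *v (B *v l))"
      for h l
      by (metis matrix_vector_mul_assoc,
          metis matrix_vector_mul_assoc minus_minus uminus_matrix_vector_mult)
    show "leibniz_algebra kn_k.scale (crossed_bracket (crossed_of_matrix t))"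
    proof (unfold_locales, rule bilinear_crossed_bracket)
      fix u v w :: "('k ^ 'n) \<times> 'k"
      show "crossed_bracket (crossed_of_matrix t) u (crossed_bracket (crossed_of_matrix t) v w) =
          crossed_bracket (crossed_of_matrix t) (crossed_bracket (crossed_of_matrix t) u v) w -
          crossed_bracket (crossed_of_matrix t) (crossed_bracket (crossed_of_matrix t) u w) v"
        unfolding t by (cases u; cases v; cases w) (simp only: lhs rhs, simp add: comm sq 0)
    qed
  qed
qed

text \<open>Triples built from matrices are bilinear whatever the matrices are, so membership comes
  down to the Leibniz identity.\<close>

lemma crossed_of_matrix_in_crossed_triples_iff:
  "crossed_of_matrix t \<in> crossed_triples (*) (*s) \<longleftrightarrow> t \<in> leibniz_matrix_triples"
proof -
  obtain ra la f where "crossed_of_matrix t = (ra, la, f)" by (cases "crossed_of_matrix t") auto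
  then show ?thesis
    using leibniz_crossed_bracket_iff[of t] bilinear_crossed_of_matrix[of t ra la f]
    by (simp add: crossed_triples_def)
qed

lemma crossed_of_matrix_of_crossed_triples:
  "t \<in> crossed_triples (*) (*s) \<Longrightarrow> crossed_of_matrix (matrix_of_crossed t) = t"
  by (cases t) (simp add: crossed_triples_def crossed_of_matrix_of_crossed)

lemma bij_betw_matrix_of_crossed:
  "bij_betw matrix_of_crossed (crossed_triples (*) (*s)) leibniz_matrix_triples"
proof (rule bij_betw_byWitness[where f' = crossed_of_matrix])
  show "\<forall>t\<in>crossed_triples (*) (*s). crossed_of_matrix (matrix_of_crossed t) = t"
    by (simp add: crossed_of_matrix_of_crossed_triples)
  \<comment> \<open>The membership criterion is read from left to right at
    \<open>matrix_of_crossed t\<close>, whose crossed triple is \<open>t\<close> itself.\<close>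
  show "matrix_of_crossed ` crossed_triples (*) (*s) \<subseteq> leibniz_matrix_triples"
    by (metis crossed_of_matrix_in_crossed_triples_iff crossed_of_matrix_of_crossed_triples image_subsetI)
qed (auto simp: matrix_of_crossed_of_matrix crossed_of_matrix_in_crossed_triples_iff)

section \<open>Comparison of the two equivalence relations\<close>

lemma crossed_of_matrix_equiv_iff:
  "(crossed_of_matrix t, crossed_of_matrix t') \<in> crossed_equiv (*) (*s) \<longleftrightarrow>
    (t, t') \<in> matrix_triple_equiv"
proof -
  obtain A B \<gamma> A' B' \<gamma>' where t: "t = (A, B, \<gamma>)" "t' = (A', B', \<gamma>')" by (cases t, cases t') auto
  have inj: "crossed_of_matrix s = crossed_of_matrix s' \<longleftrightarrow> s = s'" for s s' :: "('a, 'b) matrix_triple"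
    by (metis matrix_of_crossed_of_matrix)
  \<comment> \<open>Setting the third component to 0 on both sides turns injectivity of
    \<open>crossed_of_matrix\<close> into a statement about the two actions alone.\<close>
  have AB: "(\<lambda>g x. x *s (A *v g)) = (\<lambda>g x. x *s (A' *v g)) \<and>
      (\<lambda>x g. x *s (B *v g)) = (\<lambda>x g. x *s (B' *v g)) \<longleftrightarrow> A = A' \<and> B = B'"
    using inj[of "(A, B, 0)" "(A', B', 0)"] by (simp add: crossed_of_matrix_def)
  have "(\<exists>r. Vector_Spaces.linear (*) (*s) r \<and>
        (\<forall>x y. (x * y) *s \<gamma> = (x * y) *s \<gamma>' + x *s (B' *v r y) + y *s (A' *v r x))) \<longleftrightarrow>
      (\<exists>r. \<gamma> = \<gamma>' + (B' + A') *v r)" (is "?L \<longleftrightarrow> ?R")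
  proof
    assume ?L
    then obtain r where "\<forall>x y. (x * y) *s \<gamma> = (x * y) *s \<gamma>' + x *s (B' *v r y) + y *s (A' *v r x)"
      by blast
    \<comment> \<open>At \<open>x = y = 1\<close> the vector \<open>r 1\<close> is the required
      witness.\<close>
    from this[rule_format, of 1 1] have "\<gamma> = \<gamma>' + (B' + A') *v r 1"
      by (simp add: matrix_vector_mult_add_rdistrib)
    then show ?R ..
  next
    assume ?R
    then obtain r where r: "\<gamma> = \<gamma>' + (B' + A') *v r" ..
    show ?L
    proof (intro exI conjI)
      show "Vector_Spaces.linear (*) (*s) (\<lambda>x. x *s r)"
        by (rule vec.linear_scale_left)
      show "\<forall>x y. (x * y) *s \<gamma> = (x * y) *s \<gamma>' + x *s (B' *v (y *s r)) + y *s (A' *v (x *s r))"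
        by (simp add: r vec_simps matrix_vector_mult_add_rdistrib mult.commute)
    qed
  qed
  then show ?thesis
    using AB crossed_of_matrix_in_crossed_triples_iff[of t] crossed_of_matrix_in_crossed_triples_iff[of t']
    unfolding t by (auto simp: crossed_equiv_def matrix_triple_equiv_def crossed_of_matrix_def)
qed

section \<open>The model on the space of dimension n + 1\<close>

definition append_coord :: "('k ^ 'n) \<times> 'k \<Rightarrow> 'k ^ 'n::finite option" where
  "append_coord u = (\<chi> p. case p of Some i \<Rightarrow> fst u $ i | None \<Rightarrow> snd u)"

lemma append_coord_nth [simp]:
  "append_coord u $ Some i = fst u $ i" "append_coord u $ None = snd u"
  by (simp_all add: append_coord_def)

text \<open>The vanishing \<open>None\<close> coordinate matches the second component 0 of a crossed
  bracket.\<close>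

lemma basis_bracket_nth:
  "basis_bracket (A, B, \<gamma>) p q $ Some j =
     (case (p, q) of (Some i, None) \<Rightarrow> A $ j $ i | (None, Some i) \<Rightarrow> B $ j $ i
        | (None, None) \<Rightarrow> \<gamma> $ j | _ \<Rightarrow> 0)"
  "basis_bracket (A, B, \<gamma>) p q $ None = 0"
  by (cases p; cases q; simp add: axis_def if_distrib cong: if_cong)+

text \<open>\<open>append_coord\<close> sends (e_i, 0) to \<open>std_E (Some i)\<close> and (0, 1)
  to \<open>std_E None\<close>. Compatibility with the brackets holds for arbitrary matrices, so it
  can be used to prove that \<open>matrix_bracket\<close> is a Leibniz bracket.\<close>

lemma leibniz_iso_append_coord:
  fixes t :: "('k::field, 'n::finite) matrix_triple"
  shows "leibniz_iso kn_k.scale (crossed_bracket (crossed_of_matrix t)) (*s) (matrix_bracket t)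
    append_coord"
  unfolding leibniz_iso_def
proof (intro conjI allI)
  show "Vector_Spaces.linear kn_k.scale (*s) (append_coord :: ('k ^ 'n) \<times> 'k \<Rightarrow> _)"
    unfolding Vector_Spaces.linear_iff
    by (auto simp: kn_k.p.vector_space_axioms vec.vector_space_axioms vec_eq_iff kn_k.scale_def
        append_coord_def split: option.split)
  show "bij (append_coord :: ('k ^ 'n) \<times> 'k \<Rightarrow> _)"
    by (rule bij_betw_byWitness[where f' = "\<lambda>v. (\<chi> i. v $ Some i, v $ None)"])
      (auto simp: vec_eq_iff append_coord_def split: option.split)
  fix u v :: "('k ^ 'n) \<times> 'k"
  obtain A B \<gamma> where t: "t = (A, B, \<gamma>)" by (cases t) auto
  obtain g x h y where uv: "u = (g, x)" "v = (h, y)" by (cases u, cases v) auto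
  \<comment> \<open>Splitting both index sums into \<open>None\<close> and \<open>Some\<close>
    leaves three nonzero blocks, which are the B, A and \<open>\<gamma>\<close> terms of the crossed
    bracket.\<close>
  have "append_coord (crossed_bracket (crossed_of_matrix t) u v) $ p =
      matrix_bracket t (append_coord u) (append_coord v) $ p" for p
    by (cases p) (simp_all add: t uv crossed_bracket_of_matrix matrix_bracket_def sum_UNIV_option
        basis_bracket_nth matrix_vector_mult_def sum_distrib_left algebra_simps del: basis_bracket.simps)
  then show "append_coord (crossed_bracket (crossed_of_matrix t) u v) =
      matrix_bracket t (append_coord u) (append_coord v)"
    by (simp add: vec_eq_iff)
qed

lemma leibniz_algebra_matrix_bracket:
  "t \<in> leibniz_matrix_triples \<Longrightarrow> leibniz_algebra (*s) (matrix_bracket t)"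
  using leibniz_algebra_iso[OF leibniz_iso_append_coord _ bilinear_matrix_bracket]
  by (simp add: leibniz_crossed_bracket_iff)

section \<open>Classification of the crossed products and description of \<open>HL2\<close>\<close>

theorem corollary2p11:
  shows "(\<forall>br :: ('k::field ^ 'n::finite) \<times> 'k \<Rightarrow> ('k ^ 'n) \<times> 'k \<Rightarrow> ('k ^ 'n) \<times> 'k.
            crossed_product (*s) (*) br \<longrightarrow>
              (\<exists>t \<in> (leibniz_matrix_triples :: ('k, 'n) matrix_triple set).
                 leibniz_isomorphic (module_prod.scale (*s) (*)) br (*s) (matrix_bracket t)))
       \<and> (\<forall>t \<in> (leibniz_matrix_triples :: ('k, 'n) matrix_triple set).
            leibniz_algebra (*s) (matrix_bracket t))
       \<and> (\<exists>\<Phi>. bij_betw \<Phi> (HL2 ((*) :: 'k \<Rightarrow> 'k \<Rightarrow> 'k) ((*s) :: 'k \<Rightarrow> 'k ^ 'n \<Rightarrow> 'k ^ 'n))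
                   ((leibniz_matrix_triples :: ('k, 'n) matrix_triple set)
                      // matrix_triple_equiv)
              \<and> (\<forall>(ra, la, f) \<in> crossed_triples (*) (*s).
                   \<Phi> (crossed_equiv (*) (*s) `` {(ra, la, f)}) =
                   matrix_triple_equiv `` {(matrix (\<lambda>g. ra g 1), matrix (la 1), f 1 1)}))"
proof (intro conjI)
  show "\<forall>br :: ('k ^ 'n) \<times> 'k \<Rightarrow> ('k ^ 'n) \<times> 'k \<Rightarrow> ('k ^ 'n) \<times> 'k.
      crossed_product (*s) (*) br \<longrightarrow>
        (\<exists>t \<in> (leibniz_matrix_triples :: ('k, 'n) matrix_triple set).
           leibniz_isomorphic kn_k.scale br (*s) (matrix_bracket t))"
  proof (intro allI impI)
    fix br :: "('k ^ 'n) \<times> 'k \<Rightarrow> ('k ^ 'n) \<times> 'k \<Rightarrow> ('k ^ 'n) \<times> 'k"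
    assume "crossed_product (*s) (*) br"
    then obtain c where c: "c \<in> crossed_triples (*) (*s)" and br: "br = crossed_bracket c"
      by (auto simp: crossed_product_def)
    let ?t = "matrix_of_crossed c"
    have ct: "crossed_of_matrix ?t = c" using c by (rule crossed_of_matrix_of_crossed_triples)
    then have t: "?t \<in> leibniz_matrix_triples"
      using c crossed_of_matrix_in_crossed_triples_iff by metis
    moreover have "leibniz_isomorphic kn_k.scale br (*s) (matrix_bracket ?t)"
      using leibniz_iso_append_coord[of ?t] leibniz_crossed_bracket_iff[of ?t]
        leibniz_algebra_matrix_bracket[OF t] t
      unfolding leibniz_isomorphic_def ct br by blast
    ultimately show "\<exists>t \<in> (leibniz_matrix_triples :: ('k, 'n) matrix_triple set).
        leibniz_isomorphic kn_k.scale br (*s) (matrix_bracket t)" by blast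
  qed
next
  show "\<forall>t \<in> (leibniz_matrix_triples :: ('k, 'n) matrix_triple set).
      leibniz_algebra (*s) (matrix_bracket t)"
    by (simp add: leibniz_algebra_matrix_bracket)
next
  \<comment> \<open>On crossed triples \<open>crossed_of_matrix\<close> undoes
    \<open>matrix_of_crossed\<close>, so the comparison of the relations also reads in this
    direction.\<close>
  have rel: "(matrix_of_crossed c, matrix_of_crossed c') \<in> matrix_triple_equiv \<longleftrightarrow>
      (c, c') \<in> crossed_equiv (*) (*s)"
    if "c \<in> crossed_triples (*) (*s)" "c' \<in> crossed_triples (*) (*s)"
    for c c' :: "('k, 'k ^ 'n) crossed_triple"
    using crossed_of_matrix_equiv_iff[of "matrix_of_crossed c" "matrix_of_crossed c'"] that
    by (simp add: crossed_of_matrix_of_crossed_triples)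
  note quot = bij_betw_quotient_image[OF equiv_crossed_equiv equiv_matrix_triple_equiv
      bij_betw_matrix_of_crossed rel]
  show "\<exists>\<Phi>. bij_betw \<Phi> (HL2 ((*) :: 'k \<Rightarrow> 'k \<Rightarrow> 'k) ((*s) :: 'k \<Rightarrow> 'k ^ 'n \<Rightarrow> 'k ^ 'n))
      ((leibniz_matrix_triples :: ('k, 'n) matrix_triple set) // matrix_triple_equiv)
    \<and> (\<forall>(ra, la, f) \<in> crossed_triples (*) (*s).
         \<Phi> (crossed_equiv (*) (*s) `` {(ra, la, f)}) =
         matrix_triple_equiv `` {(matrix (\<lambda>g. ra g 1), matrix (la 1), f 1 1)})"
  proof (intro exI conjI)
    \<comment> \<open>\<open>\<Phi>\<close> maps a class to the set of images of its members, so no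
      representatives have to be chosen.\<close>
    show "bij_betw ((`) matrix_of_crossed) (HL2 ((*) :: 'k \<Rightarrow> 'k \<Rightarrow> 'k) ((*s) :: 'k \<Rightarrow> 'k ^ 'n \<Rightarrow> 'k ^ 'n))
        ((leibniz_matrix_triples :: ('k, 'n) matrix_triple set) // matrix_triple_equiv)"
      unfolding HL2_def by (rule quot(1))
    show "\<forall>(ra, la, f) \<in> crossed_triples (*) (*s).
        matrix_of_crossed ` (crossed_equiv (*) (*s) `` {(ra, la, f)}) =
        matrix_triple_equiv ``
          {(matrix (\<lambda>g. ra g 1), matrix (la 1), f 1 1) :: ('k, 'n) matrix_triple}"
    \<comment> \<open>Removing \<open>equalityI\<close> keeps the equation of classes from being
      split into two inclusions.\<close>
    proof (clarify del: equalityI)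
      fix ra la f
      assume "(ra, la, f) \<in> crossed_triples ((*) :: 'k \<Rightarrow> 'k \<Rightarrow> 'k) ((*s) :: 'k \<Rightarrow> 'k ^ 'n \<Rightarrow> 'k ^ 'n)"
      from quot(2)[OF _ _ this]
      show "matrix_of_crossed ` (crossed_equiv (*) (*s) `` {(ra, la, f)}) =
          matrix_triple_equiv `` {(matrix (\<lambda>g. ra g 1), matrix (la 1), f 1 1)}"
        by (simp add: matrix_of_crossed_def)
    qed
  qed
qed

end
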